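(* Let $k\ge 2$ and $s\ge 1$ be integers, and let $G$ be a complete multipartite graph with $k$ classes of $s$ vertices each. Then $G$ has a strong immersion of $H$, where $$H=\begin{cases} K_{(k-1)s+1} & \text{if } s \text{ is even},\\ K_{(k-1)s} & \text{if } s\neq 1 \text{ and } s \text{ is odd},\\ K_k & \text{if } s=1.\end{cases}$$
   Context: All graphs are finite and simple (no loops, no parallel edges). $K_t$ denotes the complete graph on $t$ vertices. A graph $G$ contains an immersion of a graph $H$ if there is an injective function $\phi:V(H)\to V(G)$ such that: (1) for every edge $uv\in E(H)$ there is a path $P_{uv}$ in $G$ connecting $\phi(u)$ and $\phi(v)$; (2) the paths $\{P_{uv}: uv\in E(H)\}$ are pairwise edge-disjoint. The immersion is strong if moreover the paths $P_{uv}$ are internally disjoint from $\phi(V(H))$, i.e. no internal vertex of any $P_{uv}$ lies in $\phi(V(H))$. *)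

theory Defs
  imports "Graph_Theory.Kuratowski" "HOL-Library.Disjoint_Sets"
begin

(* Finite simple graphs are the locale graph of Graph_Theory: finite, loop-free symmetric digraphs
   without parallel arcs.  An undirected edge is there a pair of opposite arcs; edges and
   edge-disjointness must therefore be expressed by the unordered set of the ends of an arc. *)

definition edge_of :: "('a, 'b) pre_digraph \<Rightarrow> 'b \<Rightarrow> 'a set" where
  "edge_of G a = {tail G a, head G a}"

definition edges :: "('a, 'b) pre_digraph \<Rightarrow> 'a set set" where
  "edges G = edge_of G ` arcs G"

definition walk_edges :: "('a, 'b) pre_digraph \<Rightarrow> 'b awalk \<Rightarrow> 'a set set" where
  "walk_edges G p = edge_of G ` set p"

(* An arc path has a direction; a path connecting x and y may be traversed either way. *)
definition path_connecting :: "('a, 'b) pre_digraph \<Rightarrow> 'a \<Rightarrow> 'a \<Rightarrow> 'b awalk \<Rightarrow> bool" where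
  "path_connecting G x y p \<longleftrightarrow> pre_digraph.apath G x p y \<or> pre_digraph.apath G y p x"

(* The paths are indexed by the undirected edges of H, one path for each edge. *)
definition immersion ::
  "('a, 'b) pre_digraph \<Rightarrow> ('c, 'd) pre_digraph \<Rightarrow> ('c \<Rightarrow> 'a) \<Rightarrow> ('c set \<Rightarrow> 'b awalk) \<Rightarrow> bool" where
  "immersion G H \<phi> P \<longleftrightarrow>
     inj_on \<phi> (verts H) \<and> \<phi> ` verts H \<subseteq> verts G \<and>
     (\<forall>u v. {u, v} \<in> edges H \<longrightarrow> path_connecting G (\<phi> u) (\<phi> v) (P {u, v})) \<and>
     disjoint_family_on (\<lambda>e. walk_edges G (P e)) (edges H)"

definition strong_immersion ::
  "('a, 'b) pre_digraph \<Rightarrow> ('c, 'd) pre_digraph \<Rightarrow> ('c \<Rightarrow> 'a) \<Rightarrow> ('c set \<Rightarrow> 'b awalk) \<Rightarrow> bool" where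
  "strong_immersion G H \<phi> P \<longleftrightarrow>
     immersion G H \<phi> P \<and>
     (\<forall>e \<in> edges H. set (pre_digraph.inner_verts G (P e)) \<inter> \<phi> ` verts H = {})"

definition has_strong_immersion :: "('a, 'b) pre_digraph \<Rightarrow> ('c, 'd) pre_digraph \<Rightarrow> bool" where
  "has_strong_immersion G H \<longleftrightarrow> (\<exists>\<phi> P. strong_immersion G H \<phi> P)"

definition complete_multipartite :: "'a set set \<Rightarrow> ('a, 'b) pre_digraph \<Rightarrow> bool" where
  "complete_multipartite \<V> G \<longleftrightarrow>
     graph G \<and> partition_on (verts G) \<V> \<and>
     arcs_ends G = {(u, v). \<exists>U \<in> \<V>. \<exists>V \<in> \<V>. U \<noteq> V \<and> u \<in> U \<and> v \<in> V}"

end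

theory Submission
  imports Defs "HOL-Number_Theory.Cong"
begin

text \<open>
  The terminals of the immersion are all vertices of all classes but one, together with at most one
  vertex of the remaining class \<open>W\<close>; the other vertices of \<open>W\<close> serve as hubs.  Two terminals in
  different classes are joined by their edge.  Two terminals \<open>u\<close>, \<open>v\<close> in a common class are joined
  by a path \<open>u, w, v\<close> of length two through a hub \<open>w\<close>, and then the only possible conflict is that
  two pairs \<open>u, v\<close> and \<open>u, v'\<close> with the same hub both use the edge \<open>uw\<close>.  So the choice of hubs has
  to be a proper edge colouring of the complete graph on each class, with the hubs as colours; the
  colourings of different classes do not interact.

  The complete graph on \<open>s\<close> vertices has a proper edge colouring with \<open>s\<close> colours if \<open>s\<close> is odd and
  with \<open>s - 1\<close> colours if \<open>s\<close> is even.  Hence all of \<open>W\<close> is needed as hubs for odd \<open>s > 1\<close>, whereas for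
  even \<open>s\<close> one vertex of \<open>W\<close> is left over and becomes the additional terminal.  For \<open>s = 1\<close> there
  is nothing to colour, so the vertex of \<open>W\<close> is again free.
\<close>

section \<open>Proper edge colourings of complete graphs\<close>

definition proper_edge_colouring :: "'a set \<Rightarrow> 'b set \<Rightarrow> ('a set \<Rightarrow> 'b) \<Rightarrow> bool" where
  "proper_edge_colouring V C c \<longleftrightarrow>
     (\<forall>u\<in>V. \<forall>v\<in>V. u \<noteq> v \<longrightarrow>
        c {u, v} \<in> C \<and> (\<forall>w\<in>V. w \<noteq> u \<and> w \<noteq> v \<longrightarrow> c {u, v} \<noteq> c {u, w}))"

lemma add_mod_left_cancel:
  fixes i j l n :: nat
  assumes "(i + j) mod n = (i + l) mod n" "j < n" "l < n"
  shows "j = l"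
  using assms by (metis cong_add_lcancel_nat cong_def mod_less)

lemma double_mod_cancel:
  fixes i j n :: nat
  assumes "(2 * i) mod n = (2 * j) mod n" "odd n" "i < n" "j < n"
  shows "i = j"
  using assms
  by (metis cong_def cong_mult_lcancel_nat coprime_left_2_iff_odd mod_less)

text \<open>
  Number the vertices by the residues modulo \<open>s\<close> and colour an edge by the sum of its ends.  This is
  proper for every number \<open>s\<close> of vertices; for odd \<open>s > 1\<close> no colouring uses fewer colours, as a
  colour class then has at most \<open>(s - 1) / 2\<close> edges.
\<close>

lemma proper_edge_colouring_card:
  assumes "finite V" "finite C" "card C = card V"
  shows "\<exists>c. proper_edge_colouring V C c"
proof -
  define n where "n = card V"
  obtain f where f: "bij_betw f V {..<n}"
    using assms(1) by (metis n_def atLeast0LessThan ex_bij_betw_finite_nat)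
  obtain g where g: "bij_betw g {..<n} C"
    using assms(2,3) by (metis n_def atLeast0LessThan ex_bij_betw_nat_finite)
  have f_less: "f v < n" if "v \<in> V" for v
    using f that by (auto simp: bij_betw_def)
  have f_inj: "f u = f v \<longleftrightarrow> u = v" if "u \<in> V" "v \<in> V" for u v
    using f that by (auto simp: bij_betw_def inj_on_def)
  have g_in: "g i \<in> C" if "i < n" for i
    using g that by (auto simp: bij_betw_def)
  have g_inj: "g i = g j \<longleftrightarrow> i = j" if "i < n" "j < n" for i j
    using g that by (auto simp: bij_betw_def inj_on_def)
  define c where "c e = g ((\<Sum>x\<in>e. f x) mod n)" for e
  have c: "c {u, v} = g ((f u + f v) mod n)" if "u \<noteq> v" for u v
    using that by (simp add: c_def)
  have "proper_edge_colouring V C c"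
    unfolding proper_edge_colouring_def
  proof (intro ballI impI conjI)
    fix u v assume uv: "u \<in> V" "v \<in> V" "u \<noteq> v"
    then have "n > 0" using f_less by fastforce
    then show "c {u, v} \<in> C" by (simp add: c uv g_in)
    fix w assume "w \<in> V" "w \<noteq> u \<and> w \<noteq> v"
    then have w: "w \<in> V" "u \<noteq> w" "v \<noteq> w" by auto
    show "c {u, v} \<noteq> c {u, w}"
    proof
      assume "c {u, v} = c {u, w}"
      then have "(f u + f v) mod n = (f u + f w) mod n"
        using uv w \<open>n > 0\<close> by (simp add: c g_inj)
      then show False
        using add_mod_left_cancel f_less f_inj uv w by blast
    qed
  qed
  then show ?thesis by blast
qed

text \<open>
  For an even number of vertices, set one vertex \<open>z\<close> aside and colour the others as before with
  their odd number \<open>n\<close> of residues.  The edges at a vertex with number \<open>i\<close> then miss exactly the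
  colour \<open>2 * i\<close>, since that would be \<open>i\<close> added to itself.  The edge to \<open>z\<close> receives this missing
  colour, and the colours of the edges at \<open>z\<close> are distinct since doubling is injective modulo the
  odd number \<open>n\<close>.
\<close>

lemma proper_edge_colouring_even:
  assumes "finite V" "finite C" "even (card V)" "card C = card V - 1"
  shows "\<exists>c. proper_edge_colouring V C c"
proof (cases "V = {}")
  case True
  then show ?thesis by (simp add: proper_edge_colouring_def)
next
  case False
  then obtain z where z: "z \<in> V" by blast
  define n where "n = card V - 1"
  have n: "card (V - {z}) = n" using z assms(1) by (simp add: n_def)
  have "card V > 0" using False assms(1) by (simp add: card_gt_0_iff)
  then have "odd n" using assms(3) by (simp add: n_def)
  then have "n > 0" by (simp add: odd_pos)
  obtain f where f: "bij_betw f (V - {z}) {..<n}"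
    using assms(1) n by (metis atLeast0LessThan ex_bij_betw_finite_nat finite_Diff)
  obtain g where g: "bij_betw g {..<n} C"
    using assms(2,4) by (metis n_def atLeast0LessThan ex_bij_betw_nat_finite)
  have f_less: "f v < n" if "v \<in> V" "v \<noteq> z" for v
    using f that by (auto simp: bij_betw_def)
  have f_inj: "f u = f v \<longleftrightarrow> u = v" if "u \<in> V" "v \<in> V" "u \<noteq> z" "v \<noteq> z" for u v
    using f that by (auto simp: bij_betw_def inj_on_def)
  have g_in: "g i \<in> C" if "i < n" for i
    using g that by (auto simp: bij_betw_def)
  have g_inj: "g i = g j \<longleftrightarrow> i = j" if "i < n" "j < n" for i j
    using g that by (auto simp: bij_betw_def inj_on_def)
  define c where
    "c e = g ((if z \<in> e then 2 * (\<Sum>x\<in>e - {z}. f x) else \<Sum>x\<in>e. f x) mod n)" for e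
  \<comment> \<open>With \<open>z\<close> given the number of the other end, every edge is coloured by the sum of its ends.\<close>
  define h where "h u v = (if v = z then f u else f v)" for u v
  have c: "c {u, v} = g ((h v u + h u v) mod n)" if "u \<noteq> v" for u v
    using that by (auto simp: c_def h_def insert_Diff_if mult_2)
  have h_less: "h u v < n" if "u \<in> V" "v \<in> V" "u \<noteq> v" for u v
    using that f_less by (auto simp: h_def)
  have "proper_edge_colouring V C c"
    unfolding proper_edge_colouring_def
  proof (intro ballI impI conjI)
    fix u v assume uv: "u \<in> V" "v \<in> V" "u \<noteq> v"
    show "c {u, v} \<in> C" using \<open>n > 0\<close> by (simp add: c uv g_in)
    fix w assume "w \<in> V" "w \<noteq> u \<and> w \<noteq> v"
    then have w: "w \<in> V" "u \<noteq> w" "v \<noteq> w" by auto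
    show "c {u, v} \<noteq> c {u, w}"
    proof
      assume "c {u, v} = c {u, w}"
      then have eq: "(h v u + h u v) mod n = (h w u + h u w) mod n"
        using uv w \<open>n > 0\<close> by (simp add: c g_inj)
      show False
      proof (cases "u = z")
        case True
        then have "(2 * f v) mod n = (2 * f w) mod n"
          using eq uv w by (simp add: h_def mult_2)
        then show False
          using double_mod_cancel \<open>odd n\<close> f_less f_inj uv w True by blast
      next
        case False
        then have "h u v = h u w"
          using eq uv w h_less add_mod_left_cancel[of "f u" "h u v" n "h u w"]
          by (simp add: h_def[of _ u])
        then show False
          using False uv w f_inj by (auto simp: h_def split: if_splits)
      qed
    qed
  qed
  then show ?thesis by blast
qed

section \<open>Immersions with paths of length at most two\<close>

lemma (in sym_digraph) edge_mem_edges_iff: "{u, v} \<in> edges G \<longleftrightarrow> u \<rightarrow>\<^bsub>G\<^esub> v"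
  using arcs_ends_symmetric[OF sym_arcs]
  by (auto simp: edges_def edge_of_def arcs_ends_conv image_iff doubleton_eq_iff)

lemma path_connecting_commute: "path_connecting G x y p \<longleftrightarrow> path_connecting G y x p"
  by (auto simp: path_connecting_def)

lemma (in wf_digraph) direct_path:
  assumes "u \<rightarrow>\<^bsub>G\<^esub> v" "u \<noteq> v"
  shows "\<exists>p. apath u p v \<and> walk_edges G p = {{u, v}} \<and> set (inner_verts p) = {}"
proof -
  obtain a where "a \<in> arcs G" "tail G a = u" "head G a = v"
    using assms(1) by (rule reachableE)
  then show ?thesis
    using assms(2)
    by (intro exI[of _ "[a]"])
       (auto simp: apath_def awalk_def walk_edges_def edge_of_def)
qed

lemma (in wf_digraph) two_arc_path:
  assumes "u \<rightarrow>\<^bsub>G\<^esub> w" "w \<rightarrow>\<^bsub>G\<^esub> v" "distinct [u, w, v]"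
  shows "\<exists>p. apath u p v \<and> walk_edges G p = {{u, w}, {w, v}} \<and> set (inner_verts p) = {w}"
proof -
  obtain a where "a \<in> arcs G" "tail G a = u" "head G a = w"
    using assms(1) by (rule reachableE)
  moreover obtain b where "b \<in> arcs G" "tail G b = w" "head G b = v"
    using assms(2) by (rule reachableE)
  ultimately show ?thesis
    using assms(3)
    by (intro exI[of _ "[a, b]"])
       (auto simp: apath_def awalk_def walk_edges_def edge_of_def inner_verts_def)
qed

text \<open>
  This holds in every graph: it suffices to choose for each non-adjacent pair of terminals a common
  neighbour outside \<open>T\<close> such that pairs with a common terminal get different neighbours.
  A path through a hub only uses edges with exactly one end in \<open>T\<close>, so it never meets an edge
  joining two terminals, and the edge \<open>xw\<close> with \<open>x\<close> in \<open>T\<close> determines the terminal \<open>x\<close> and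
  the hub \<open>w\<close>, hence the pair that uses it.
\<close>

lemma (in graph) has_strong_immersion_via_hubs:
  fixes H :: "('c, 'd) pre_digraph" and c :: "'a set \<Rightarrow> 'a"
  assumes H: "complete_digraph (card T) H"
    and T: "T \<subseteq> verts G"
    and hub: "\<And>u v. \<lbrakk>u \<in> T; v \<in> T; u \<noteq> v; \<not> u \<rightarrow>\<^bsub>G\<^esub> v\<rbrakk> \<Longrightarrow> c {u, v} \<notin> T \<and> u \<rightarrow>\<^bsub>G\<^esub> c {u, v}"
    and hubs_differ: "\<And>u v w. \<lbrakk>u \<in> T; v \<in> T; w \<in> T; distinct [u, v, w];
        \<not> u \<rightarrow>\<^bsub>G\<^esub> v; \<not> u \<rightarrow>\<^bsub>G\<^esub> w\<rbrakk> \<Longrightarrow> c {u, v} \<noteq> c {u, w}"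
  shows "has_strong_immersion G H"
proof -
  have sym: "v \<rightarrow>\<^bsub>G\<^esub> u" if "u \<rightarrow>\<^bsub>G\<^esub> v" for u v
    using that arcs_ends_symmetric[OF sym_arcs] by blast
  interpret H: graph H using H by (simp add: complete_digraph_def)
  have H_edge: "{u, v} \<in> edges H \<longleftrightarrow> u \<in> verts H \<and> v \<in> verts H \<and> u \<noteq> v" for u v
    using H by (simp add: H.edge_mem_edges_iff complete_digraph_def)
  have H_edgeE: "\<exists>u v. e = {u, v} \<and> u \<in> verts H \<and> v \<in> verts H \<and> u \<noteq> v" if e: "e \<in> edges H" for e
  proof -
    obtain u v where "e = {u, v}" using e unfolding edges_def edge_of_def by auto
    then show ?thesis using e H_edge by blast
  qed
  have "finite T" using T finite_verts finite_subset by blast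
  moreover have "card (verts H) = card T" using H by (simp add: complete_digraph_def)
  ultimately obtain \<phi> where \<phi>: "bij_betw \<phi> (verts H) T"
    using H.finite_verts finite_same_card_bij by blast
  then have \<phi>_inj: "inj_on \<phi> (verts H)" and \<phi>_img: "\<phi> ` verts H = T"
    by (auto simp: bij_betw_def)

  \<comment> \<open>The path for the terminal pair \<open>X\<close> may run in either direction, but its edge set depends
    on \<open>X\<close> only.\<close>
  define route where
    "route X = (if X \<in> edges G then {X} else (\<lambda>x. {x, c X}) ` X)" for X

  have "\<exists>p. (\<forall>u v. e = {u, v} \<longrightarrow> path_connecting G (\<phi> u) (\<phi> v) p) \<and>
            walk_edges G p = route (\<phi> ` e) \<and> set (inner_verts p) \<inter> T = {}"
    if e: "e \<in> edges H" for e
  proof -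
    obtain u v where uv: "e = {u, v}" "u \<in> verts H" "v \<in> verts H" "u \<noteq> v"
      using H_edgeE[OF e] by blast
    then have ends: "\<phi> u \<in> T" "\<phi> v \<in> T" "\<phi> u \<noteq> \<phi> v"
      using \<phi>_img \<phi>_inj by (auto dest: inj_onD)
    have "\<exists>p. apath (\<phi> u) p (\<phi> v) \<and>
        walk_edges G p = route {\<phi> u, \<phi> v} \<and> set (inner_verts p) \<inter> T = {}"
    proof (cases "\<phi> u \<rightarrow>\<^bsub>G\<^esub> \<phi> v")
      case True
      then show ?thesis
        using direct_path[of "\<phi> u" "\<phi> v"] ends by (auto simp: route_def edge_mem_edges_iff)
    next
      case False
      define w where "w = c {\<phi> u, \<phi> v}"
      have w: "w \<notin> T" "\<phi> u \<rightarrow>\<^bsub>G\<^esub> w"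
        using hub ends False by (auto simp: w_def)
      have "\<not> \<phi> v \<rightarrow>\<^bsub>G\<^esub> \<phi> u" using False sym by blast
      then have "\<phi> v \<rightarrow>\<^bsub>G\<^esub> w"
        using hub[of "\<phi> v" "\<phi> u"] ends by (simp add: w_def insert_commute)
      then obtain p where "apath (\<phi> u) p (\<phi> v)" "set (inner_verts p) = {w}"
          "walk_edges G p = {{\<phi> u, w}, {w, \<phi> v}}"
        using two_arc_path[of "\<phi> u" w "\<phi> v"] w sym ends by auto
      then show ?thesis
        using w False
        by (intro exI[of _ p]) (auto simp: route_def edge_mem_edges_iff w_def insert_commute)
    qed
    then obtain p where p: "path_connecting G (\<phi> u) (\<phi> v) p"
        "walk_edges G p = route (\<phi> ` e)" "set (inner_verts p) \<inter> T = {}"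
      unfolding path_connecting_def uv(1) by auto
    have "\<forall>x y. e = {x, y} \<longrightarrow> path_connecting G (\<phi> x) (\<phi> y) p"
      using p(1) path_connecting_commute[of G] uv(1) by (auto simp: doubleton_eq_iff)
    with p(2,3) show ?thesis by blast
  qed
  then obtain P where P:
      "\<And>u v. {u, v} \<in> edges H \<Longrightarrow> path_connecting G (\<phi> u) (\<phi> v) (P {u, v})"
      "\<And>e. e \<in> edges H \<Longrightarrow> walk_edges G (P e) = route (\<phi> ` e)"
      "\<And>e. e \<in> edges H \<Longrightarrow> set (inner_verts (P e)) \<inter> T = {}"
    by metis

  have routes_disjoint: "route X \<inter> route Y = {}"
    if X: "X = {a, b}" "a \<in> T" "b \<in> T" "a \<noteq> b"
      and Y: "Y = {a', b'}" "a' \<in> T" "b' \<in> T" "a' \<noteq> b'" and "X \<noteq> Y"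
    for X Y a b a' b'
  proof -
    have hub': "c Z \<notin> T" if "Z \<notin> edges G" "Z = {x, y}" "x \<in> T" "y \<in> T" "x \<noteq> y" for Z x y
      using that hub[of x y] by (auto simp: edge_mem_edges_iff)
    have False if common: "{x, c X} = {y, c Y}" "x \<in> X" "y \<in> Y" "X \<notin> edges G" "Y \<notin> edges G" for x y
    proof -
      have "c X \<notin> T" "c Y \<notin> T"
        using hub' common X Y by blast+
      then have eq: "x = y" "c X = c Y"
        using common X Y by (auto simp: doubleton_eq_iff)
      obtain v where v: "X = {x, v}" "v \<in> T" "v \<noteq> x"
        using X common(2) by blast
      obtain w where w: "Y = {x, w}" "w \<in> T" "w \<noteq> x"
        using Y common(3) eq(1) by blast
      have "\<not> x \<rightarrow>\<^bsub>G\<^esub> v" "\<not> x \<rightarrow>\<^bsub>G\<^esub> w"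
        using common(4,5) by (simp_all add: v(1) w(1) edge_mem_edges_iff)
      moreover have "x \<in> T" using X common(2) by blast
      moreover have "v \<noteq> w" using \<open>X \<noteq> Y\<close> v(1) w(1) by blast
      ultimately have "c {x, v} \<noteq> c {x, w}"
        using v(2,3) w(2,3) by (intro hubs_differ) auto
      then show False using eq(2) v(1) w(1) by simp
    qed
    moreover have "X \<noteq> {y, c Y}" if "Y \<notin> edges G" for y
      using hub'[OF that Y] X by auto
    moreover have "Y \<noteq> {x, c X}" if "X \<notin> edges G" for x
      using hub'[OF that X] Y by auto
    ultimately show ?thesis
      using \<open>X \<noteq> Y\<close> by (auto simp: route_def)
  qed

  have "disjoint_family_on (\<lambda>e. walk_edges G (P e)) (edges H)"
    unfolding disjoint_family_on_def
  proof (intro ballI impI)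
    fix d e assume de: "d \<in> edges H" "e \<in> edges H" "d \<noteq> e"
    obtain u v where d: "d = {u, v}" "u \<in> verts H" "v \<in> verts H" "u \<noteq> v"
      using H_edgeE[OF de(1)] by blast
    obtain u' v' where e: "e = {u', v'}" "u' \<in> verts H" "v' \<in> verts H" "u' \<noteq> v'"
      using H_edgeE[OF de(2)] by blast
    have "\<phi> ` d \<noteq> \<phi> ` e"
      using \<phi>_inj de(3) d e by (simp add: inj_on_image_eq_iff del: image_insert)
    moreover have "\<phi> u \<noteq> \<phi> v" "\<phi> u' \<noteq> \<phi> v'"
      using \<phi>_inj d e by (auto dest: inj_onD)
    ultimately have "route (\<phi> ` d) \<inter> route (\<phi> ` e) = {}"
      using routes_disjoint[of "\<phi> ` d" "\<phi> u" "\<phi> v" "\<phi> ` e" "\<phi> u'" "\<phi> v'"] d e \<phi>_img by blast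
    then show "walk_edges G (P d) \<inter> walk_edges G (P e) = {}"
      using P(2) de by simp
  qed
  then have "strong_immersion G H \<phi> P"
    using P \<phi>_inj \<phi>_img T by (simp add: strong_immersion_def immersion_def)
  then show ?thesis unfolding has_strong_immersion_def by blast
qed

section \<open>Complete multipartite graphs\<close>

text \<open>
  If every class but \<open>W\<close> can be coloured with the vertices of \<open>W - S\<close>, these colourings choose
  the hubs, and all other vertices are terminals.  The set \<open>S\<close> must not contain two vertices
  because these would be non-adjacent terminals without a hub.
\<close>

lemma complete_multipartite_has_strong_immersion:
  fixes G :: "('a, 'b) pre_digraph" and H :: "('c, 'd) pre_digraph"
  assumes G: "complete_multipartite \<V> G"
    and W: "W \<in> \<V>" "S \<subseteq> W" "card S \<le> 1"
    and col: "\<And>V. \<lbrakk>V \<in> \<V>; V \<noteq> W\<rbrakk> \<Longrightarrow> \<exists>c. proper_edge_colouring V (W - S) c"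
    and H: "complete_digraph (card (\<Union>(\<V> - {W}) \<union> S)) H"
  shows "has_strong_immersion G H"
proof -
  interpret graph G using G by (simp add: complete_multipartite_def)
  have part: "partition_on (verts G) \<V>"
    using G by (simp add: complete_multipartite_def)
  have adj: "u \<rightarrow>\<^bsub>G\<^esub> v \<longleftrightarrow> (\<exists>U\<in>\<V>. \<exists>V\<in>\<V>. U \<noteq> V \<and> u \<in> U \<and> v \<in> V)" for u v
    using G by (simp add: complete_multipartite_def)
  have union: "\<Union>\<V> = verts G" and disj: "\<And>U V x. \<lbrakk>U \<in> \<V>; V \<in> \<V>; x \<in> U; x \<in> V\<rbrakk> \<Longrightarrow> U = V"
    using part by (auto simp: partition_on_def disjoint_def)
  have "finite S"
    using W union finite_verts by (metis Union_upper finite_subset)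
  then have S: "x = y" if "x \<in> S" "y \<in> S" for x y
    using W(3) that by (auto simp: card_le_Suc0_iff_eq)
  define T where "T = \<Union>(\<V> - {W}) \<union> S"
  have T_iff: "x \<in> T \<longleftrightarrow> (\<exists>V\<in>\<V>. V \<noteq> W \<and> x \<in> V) \<or> x \<in> S" for x
    by (auto simp: T_def)

  obtain C where C: "\<And>V. \<lbrakk>V \<in> \<V>; V \<noteq> W\<rbrakk> \<Longrightarrow> proper_edge_colouring V (W - S) (C V)"
    using col by metis
  define c where "c e = C (THE V. V \<in> \<V> \<and> e \<subseteq> V) e" for e
  have c: "c {u, v} = C V {u, v}" if "V \<in> \<V>" "u \<in> V" "v \<in> V" for u v V
  proof -
    have "(THE U. U \<in> \<V> \<and> {u, v} \<subseteq> U) = V"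
      using that disj by (intro the_equality) blast+
    then show ?thesis by (simp add: c_def)
  qed
  have same_class: "\<exists>V\<in>\<V>. V \<noteq> W \<and> u \<in> V \<and> v \<in> V"
    if uv: "u \<in> T" "v \<in> T" "u \<noteq> v" "\<not> u \<rightarrow>\<^bsub>G\<^esub> v" for u v
  proof -
    obtain U V where "U \<in> \<V>" "u \<in> U" "V \<in> \<V>" "v \<in> V"
      using uv(1,2) W(1,2) unfolding T_iff by blast
    moreover from this have "U = V" using uv(4) unfolding adj by blast
    moreover have "\<not> (u \<in> W \<and> v \<in> W)"
    proof
      assume "u \<in> W \<and> v \<in> W"
      then have "u \<in> S" "v \<in> S"
        using uv(1,2) disj[OF W(1)] unfolding T_iff by blast+
      then show False using S uv(3) by blast
    qed
    ultimately show ?thesis by blast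
  qed

  show ?thesis
  proof (rule has_strong_immersion_via_hubs[where T = T and c = c])
    show "complete_digraph (card T) H" using H by (simp add: T_def)
    show "T \<subseteq> verts G" using union W by (auto simp: T_def)
  next
    fix u v assume uv: "u \<in> T" "v \<in> T" "u \<noteq> v" "\<not> u \<rightarrow>\<^bsub>G\<^esub> v"
    obtain V where V: "V \<in> \<V>" "V \<noteq> W" "u \<in> V" "v \<in> V"
      using same_class uv by blast
    then have "c {u, v} \<in> W - S"
      using C[of V] uv(3) c[of V u v] by (simp add: proper_edge_colouring_def)
    then show "c {u, v} \<notin> T \<and> u \<rightarrow>\<^bsub>G\<^esub> c {u, v}"
      using V W disj by (auto simp: T_iff adj)
  next
    fix u v w
    assume T: "u \<in> T" "v \<in> T" "w \<in> T" and dist: "distinct [u, v, w]"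
      and nonadj: "\<not> u \<rightarrow>\<^bsub>G\<^esub> v" "\<not> u \<rightarrow>\<^bsub>G\<^esub> w"
    obtain V where V: "V \<in> \<V>" "V \<noteq> W" "u \<in> V" "v \<in> V"
      using same_class[of u v] T nonadj dist by auto
    then have "w \<in> V"
      using same_class[of u w] T nonadj dist disj by fastforce
    then show "c {u, v} \<noteq> c {u, w}"
      using C[of V] V dist c[of V u] by (auto simp: proper_edge_colouring_def)
  qed
qed

theorem theorem1p2:
  fixes k s :: nat
    and G :: "('a, 'b) pre_digraph" and \<V> :: "'a set set"
    and H :: "('c, 'd) pre_digraph"
  assumes "k \<ge> 2" and "s \<ge> 1"
    and "complete_multipartite \<V> G" and "card \<V> = k" and "\<forall>V \<in> \<V>. card V = s"
    and "complete_digraph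
           (if even s then (k - 1) * s + 1
            else if s \<noteq> 1 then (k - 1) * s
            else k) H"
  shows "has_strong_immersion G H"
proof -
  interpret graph G using assms(3) by (simp add: complete_multipartite_def)
  have part: "partition_on (verts G) \<V>"
    using assms(3) by (simp add: complete_multipartite_def)
  have fin: "finite V" if "V \<in> \<V>" for V
    using that assms(2,5) by (metis card.infinite not_one_le_zero)
  have "finite \<V>" using assms(1,4) by (metis card.infinite not_numeral_le_zero)
  obtain W where W: "W \<in> \<V>" using assms(1,4) by fastforce
  define t :: nat where "t = (if even s \<or> s = 1 then 1 else 0)"
  have "t \<le> card W" using W assms(2,5) by (simp add: t_def)
  then obtain S where S: "S \<subseteq> W" "card S = t"
    by (meson obtain_subset_with_card_n)
  have "finite (W - S)" and card_hubs: "card (W - S) = s - t"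
    using S W fin assms(5) by (auto simp: card_Diff_subset finite_subset)
  have colouring: "\<exists>c. proper_edge_colouring V (W - S) c" if "V \<in> \<V>" for V
  proof -
    have V: "finite V" "card V = s" using that fin assms(5) by auto
    consider "s = 1" | "even s" | "odd s" "s \<noteq> 1" by blast
    then show ?thesis
    proof cases
      case 1
      then have "\<exists>x. V = {x}" using V by (simp add: card_1_singleton_iff)
      then show ?thesis by (auto simp: proper_edge_colouring_def)
    next
      case 2
      then show ?thesis
        using V \<open>finite (W - S)\<close> card_hubs by (intro proper_edge_colouring_even) (auto simp: t_def)
    next
      case 3
      then show ?thesis
        using V \<open>finite (W - S)\<close> card_hubs by (intro proper_edge_colouring_card) (auto simp: t_def)
    qed
  qed
  have disj: "disjoint \<V>" using part by (simp add: partition_on_def)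
  have "card (\<Union>(\<V> - {W})) = (\<Sum>V\<in>\<V> - {W}. card V)"
    using disj fin by (intro card_Union_disjoint) (auto simp: pairwise_def disjnt_def disjoint_def)
  also have "\<dots> = (k - 1) * s"
    using assms(4,5) W \<open>finite \<V>\<close> by simp
  finally have "card (\<Union>(\<V> - {W})) = (k - 1) * s" .
  moreover have "\<Union>(\<V> - {W}) \<inter> S = {}"
    using disj W S by (fastforce simp: disjoint_def)
  ultimately have "card (\<Union>(\<V> - {W}) \<union> S) = (k - 1) * s + t"
    using S W fin \<open>finite \<V>\<close> by (subst card_Un_disjoint) (auto intro: finite_subset)
  also have "\<dots> = (if even s then (k - 1) * s + 1 else if s \<noteq> 1 then (k - 1) * s else k)"
    using assms(1) by (auto simp: t_def)
  finally have "complete_digraph (card (\<Union>(\<V> - {W}) \<union> S)) H"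
    using assms(6) by simp
  moreover have "card S \<le> 1" using S by (simp add: t_def)
  ultimately show ?thesis
    using complete_multipartite_has_strong_immersion[OF assms(3) W S(1)] colouring by blast
qed

end
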